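(* Let $m\ge 1$, let $z_1,\dots,z_m\in\mathbb{C}_+$, and let $\Theta_\Delta$ be the interpolation L-system with nodes $z_1,\dots,z_m$, whose transfer function is $W_{\Theta_\Delta}(z)=\prod_{k=1}^m\frac{z-\bar z_k}{z-z_k}$. Then the c-entropy of $\Theta_\Delta$ is $$\mathcal{S}(\Theta_\Delta)=\frac12\sum_{k=1}^m\ln\left(\frac{(\operatorname{Re}z_k)^2+(1+\operatorname{Im}z_k)^2}{(\operatorname{Re}z_k)^2+(1-\operatorname{Im}z_k)^2}\right).$$
   Context: $\mathbb{C}_+$ is the open upper half-plane. A scalar (canonical) L-system is an array $\Theta=\begin{pmatrix}T&K&1\\ \mathcal{H}&&\mathbb{C}\end{pmatrix}$, where $\mathcal{H}$ is a Hilbert space, $T$ is a bounded operator on $\mathcal{H}$, and $K:\mathbb{C}\to\mathcal{H}$ is linear with $\operatorname{Im}T:=\frac1{2i}(T-T^* )=KK^*$. Its transfer function is $W_\Theta(z)=1-2iK^*(T-zI)^{-1}K$, $z\in\rho(T)$. Its c-entropy is $\mathcal{S}(\Theta)=-\ln|W_\Theta(-i)|\in[0,+\infty]$, with $-\ln 0=+\infty$ (correspondingly, a summand whose denominator vanishes, i.e. $z_k=i$, is read as $+\infty$). For $z_1,\dots,z_m\in\mathbb{C}_+$ the interpolation L-system is $\Theta_\Delta=\begin{pmatrix}T_\Delta&K_\Delta&1\\ \mathbb{C}^m&&\mathbb{C}\end{pmatrix}$, where $T_\Delta$ is the upper triangular $m\times m$ matrix with diagonal entries $z_1,\dots,z_m$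 and $(j,k)$ entry $2i\sqrt{\operatorname{Im}z_j\cdot\operatorname{Im}z_k}$ for $j<k$ (zero for $j>k$), and $K_\Delta c=c\,g_\Delta$ with $g_\Delta=(\sqrt{\operatorname{Im}z_1},\dots,\sqrt{\operatorname{Im}z_m})^T$. Its transfer function is $W_{\Theta_\Delta}(z)=\prod_{k=1}^m\frac{z-\bar z_k}{z-z_k}$ (a known fact). *)

theory Defs
  imports "HOL-Analysis.Analysis"
begin

text \<open>Complex Hilbert spaces. The real part of the complex inner product is the real inner
  product of the underlying real Hilbert space, so norm, topology and completeness are the
  library's. The complex inner product is linear in its first argument.\<close>

class complex_hilbert = real_inner + complete_space +
  fixes scaleC :: "complex \<Rightarrow> 'a \<Rightarrow> 'a" (infixr \<open>*\<^sub>C\<close> 75)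
    and cinner :: "'a \<Rightarrow> 'a \<Rightarrow> complex"
  assumes scaleC_add_right: "c *\<^sub>C (x + y) = c *\<^sub>C x + c *\<^sub>C y"
    and scaleC_add_left: "(c + d) *\<^sub>C x = c *\<^sub>C x + d *\<^sub>C x"
    and scaleC_scaleC: "c *\<^sub>C d *\<^sub>C x = (c * d) *\<^sub>C x"
    and scaleR_conv_scaleC: "r *\<^sub>R x = complex_of_real r *\<^sub>C x"
    and cinner_commute: "cinner x y = cnj (cinner y x)"
    and cinner_add_left: "cinner (x + y) w = cinner x w + cinner y w"
    and cinner_scaleC_left: "cinner (c *\<^sub>C x) y = c * cinner x y"
    and inner_conv_Re_cinner: "x \<bullet> y = Re (cinner x y)"

instantiation complex :: complex_hilbert
begin

definition scaleC_complex :: "complex \<Rightarrow> complex \<Rightarrow> complex"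
  where "scaleC_complex c x = c * x"

definition cinner_complex :: "complex \<Rightarrow> complex \<Rightarrow> complex"
  where "cinner_complex x y = x * cnj y"

instance
  by standard
    (auto simp: scaleC_complex_def cinner_complex_def inner_complex_def scaleR_conv_of_real
      algebra_simps)

end

instantiation vec :: (complex_hilbert, finite) complex_hilbert
begin

definition scaleC_vec :: "complex \<Rightarrow> 'a ^ 'b \<Rightarrow> 'a ^ 'b"
  where "scaleC_vec c x = (\<chi> i. c *\<^sub>C (x $ i))"

definition cinner_vec :: "'a ^ 'b \<Rightarrow> 'a ^ 'b \<Rightarrow> complex"
  where "cinner_vec x y = (\<Sum>i\<in>UNIV. cinner (x $ i) (y $ i))"

instance
proof
  fix c d :: complex and r :: real and x y w :: "'a ^ 'b"
  show "c *\<^sub>C (x + y) = c *\<^sub>C x + c *\<^sub>C y" "(c + d) *\<^sub>C x = c *\<^sub>C x + d *\<^sub>C x"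
    "c *\<^sub>C d *\<^sub>C x = (c * d) *\<^sub>C x" "r *\<^sub>R x = complex_of_real r *\<^sub>C x"
    by (simp_all add: vec_eq_iff scaleC_vec_def scaleC_add_right scaleC_add_left scaleC_scaleC
        scaleR_conv_scaleC)
  show "cinner x y = cnj (cinner y x)"
    unfolding cinner_vec_def cnj_sum by (intro sum.cong refl cinner_commute)
  show "cinner (x + y) w = cinner x w + cinner y w"
    by (simp add: cinner_vec_def cinner_add_left sum.distrib)
  show "cinner (c *\<^sub>C x) y = c * cinner x y"
    by (simp add: cinner_vec_def scaleC_vec_def cinner_scaleC_left sum_distrib_left)
  show "x \<bullet> y = Re (cinner x y)"
    by (simp add: inner_vec_def cinner_vec_def inner_conv_Re_cinner)
qed

end

definition bounded_clinear :: "('a::complex_hilbert \<Rightarrow> 'b::complex_hilbert) \<Rightarrow> bool"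
  where "bounded_clinear f \<longleftrightarrow> bounded_linear f \<and> (\<forall>c x. f (c *\<^sub>C x) = c *\<^sub>C f x)"

definition cadjoint :: "('a::complex_hilbert \<Rightarrow> 'b::complex_hilbert) \<Rightarrow> 'b \<Rightarrow> 'a"
  where "cadjoint f = (SOME f'. \<forall>x y. cinner (f x) y = cinner x (f' y))"

lemma cadjoint_unique:
  fixes f :: "'a::complex_hilbert \<Rightarrow> 'b::complex_hilbert"
  assumes "\<And>x y. cinner (f x) y = cinner x (f' y)"
  shows "cadjoint f = f'"
proof
  fix y
  have "\<forall>x y. cinner (f x) y = cinner x (cadjoint f y)"
    unfolding cadjoint_def by (rule someI[of _ f']) (use assms in blast)
  then have "x \<bullet> cadjoint f y = x \<bullet> f' y" for x
    by (metis assms inner_conv_Re_cinner)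
  then show "cadjoint f y = f' y"
    by (metis vector_eq_rdot inner_commute)
qed

definition resolvent_set :: "('a::complex_hilbert \<Rightarrow> 'a) \<Rightarrow> complex set"
  where "resolvent_set T = {w. bij (\<lambda>x. T x - w *\<^sub>C x) \<and> bounded_clinear (inv (\<lambda>x. T x - w *\<^sub>C x))}"

text \<open>A scalar array is determined by its operators; the state space is the type \<open>'h\<close>.\<close>

record 'h system_array =
  state_operator :: "'h \<Rightarrow> 'h"
  channel_operator :: "complex \<Rightarrow> 'h"

definition is_L_system :: "'h::complex_hilbert system_array \<Rightarrow> bool"
  where "is_L_system \<Theta> \<longleftrightarrow>
    bounded_clinear (state_operator \<Theta>) \<and> bounded_clinear (channel_operator \<Theta>) \<and>
    (\<forall>x. (1 / (2 * \<i>)) *\<^sub>C (state_operator \<Theta> x - cadjoint (state_operator \<Theta>) x)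
       = channel_operator \<Theta> (cadjoint (channel_operator \<Theta>) x))"

text \<open>The value is meaningful only for \<open>w\<close> in the resolvent set of the state operator. The
  operator \<open>K\<^sup>* (T - w I)\<^sup>-\<^sup>1 K\<close> on the complex numbers is identified with its value at \<open>1\<close>.\<close>

definition transfer_function :: "'h::complex_hilbert system_array \<Rightarrow> complex \<Rightarrow> complex"
  where "transfer_function \<Theta> w =
    1 - 2 * \<i> * cadjoint (channel_operator \<Theta>)
      (inv (\<lambda>x. state_operator \<Theta> x - w *\<^sub>C x) (channel_operator \<Theta> 1))"

text \<open>The extended logarithm: \<open>ln 0 = - \<infinity>\<close> and \<open>ln \<infinity> = \<infinity>\<close>.\<close>

definition eln :: "ereal \<Rightarrow> ereal"
  where "eln x = (if x \<le> 0 then - \<infinity> else if x = \<infinity> then \<infinity> else ereal (ln (real_of_ereal x)))"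

definition c_entropy :: "'h::complex_hilbert system_array \<Rightarrow> ereal"
  where "c_entropy \<Theta> = - eln (ereal (cmod (transfer_function \<Theta> (- \<i>))))"

text \<open>The nodes are indexed by a finite linearly ordered type \<open>'n\<close>, playing the role of
  \<open>{1, \<dots>, m}\<close> with \<open>m = CARD('n)\<close>.\<close>

definition interpolation_matrix :: "('n::{finite,linorder} \<Rightarrow> complex) \<Rightarrow> ((complex, 'n) vec, 'n) vec"
  where "interpolation_matrix z = (\<chi> j k.
    if j = k then z k
    else if j < k then 2 * \<i> * complex_of_real (sqrt (Im (z j) * Im (z k)))
    else 0)"

definition interpolation_vector :: "('n::finite \<Rightarrow> complex) \<Rightarrow> complex ^ 'n"
  where "interpolation_vector z = (\<chi> k. complex_of_real (sqrt (Im (z k))))"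

definition interpolation_system ::
    "('n::{finite,linorder} \<Rightarrow> complex) \<Rightarrow> (complex, 'n) vec system_array"
  where "interpolation_system z =
    \<lparr>state_operator = (\<lambda>x. interpolation_matrix z *v x),
     channel_operator = (\<lambda>c. c *\<^sub>C interpolation_vector z)\<rparr>"

lemma bounded_clinear_matrix_vector_mult:
  fixes A :: "complex ^ 'n ^ 'm"
  shows "bounded_clinear (\<lambda>x. A *v x)"
proof -
  have "linear (\<lambda>x. A *v x)"
    by (rule linearI)
      (simp_all add: vec_eq_iff matrix_vector_mult_def sum.distrib algebra_simps scaleR_sum_right)
  moreover have "A *v (c *\<^sub>C x) = c *\<^sub>C (A *v x)" for c x
    by (simp add: vec_eq_iff matrix_vector_mult_def scaleC_vec_def scaleC_complex_def
        sum_distrib_left algebra_simps)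
  ultimately show ?thesis
    by (simp add: bounded_clinear_def linear_conv_bounded_linear)
qed

lemma cadjoint_matrix_vector_mult:
  fixes A :: "complex ^ 'n ^ 'm"
  shows "cadjoint (\<lambda>x. A *v x) = (\<lambda>y. (\<chi> i j. cnj (A $ j $ i)) *v y)"
proof (rule cadjoint_unique)
  fix x y
  have "cinner (A *v x) y = (\<Sum>j\<in>UNIV. \<Sum>i\<in>UNIV. A $ j $ i * x $ i * cnj (y $ j))"
    by (simp add: cinner_vec_def cinner_complex_def matrix_vector_mult_def sum_distrib_right)
  also have "\<dots> = (\<Sum>i\<in>UNIV. \<Sum>j\<in>UNIV. A $ j $ i * x $ i * cnj (y $ j))"
    by (rule sum.swap)
  also have "\<dots> = cinner x ((\<chi> i j. cnj (A $ j $ i)) *v y)"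
    by (simp add: cinner_vec_def cinner_complex_def matrix_vector_mult_def sum_distrib_left
        algebra_simps)
  finally show "cinner (A *v x) y = cinner x ((\<chi> i j. cnj (A $ j $ i)) *v y)" .
qed

lemma cadjoint_scaleC_vector:
  fixes g :: "complex ^ 'n"
  shows "cadjoint (\<lambda>c. c *\<^sub>C g) = (\<lambda>x. cinner x g)"
  by (rule cadjoint_unique)
    (simp add: cinner_scaleC_left cinner_complex_def cinner_commute[of _ g])

lemma is_L_system_interpolation_system:
  fixes z :: "'n::{finite,linorder} \<Rightarrow> complex"
  assumes "\<And>k. Im (z k) > 0"
  shows "is_L_system (interpolation_system z)"
proof -
  let ?g = "interpolation_vector z" and ?A = "interpolation_matrix z"
  have entry: "(?A $ j $ k - cnj (?A $ k $ j)) / (2 * \<i>) = ?g $ j * cnj (?g $ k)" for j k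
  proof -
    have "\<bar>Im (z k)\<bar> = Im (z k)" "(z k - cnj (z k)) / (2 * \<i>) = complex_of_real (Im (z k))"
      using assms[of k] by (simp_all add: complex_diff_cnj field_simps)
    then show ?thesis
      by (cases j k rule: linorder_cases)
        (auto simp: interpolation_matrix_def interpolation_vector_def real_sqrt_mult
          simp flip: of_real_mult)
  qed
  have "(1 / (2 * \<i>)) *\<^sub>C (?A *v x - (\<chi> i j. cnj (?A $ j $ i)) *v x) = cinner x ?g *\<^sub>C ?g" for x
  proof -
    have "1 / (2 * \<i>) * (\<Sum>k\<in>UNIV. ?A $ j $ k * x $ k - cnj (?A $ k $ j) * x $ k)
        = (\<Sum>k\<in>UNIV. (?A $ j $ k - cnj (?A $ k $ j)) / (2 * \<i>) * x $ k)" for j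
      unfolding sum_distrib_left by (intro sum.cong refl) (simp add: field_simps)
    then show ?thesis
      unfolding vec_eq_iff entry
      by (simp add: scaleC_vec_def scaleC_complex_def matrix_vector_mult_def cinner_vec_def
          cinner_complex_def sum_distrib_left algebra_simps flip: sum_subtractf)
  qed
  moreover have "bounded_clinear (\<lambda>c. c *\<^sub>C ?g)"
  proof -
    have "linear (\<lambda>c. c *\<^sub>C ?g)"
      by (rule linearI) (simp_all add: scaleC_add_left scaleC_scaleC scaleR_conv_scaleC
          scaleC_complex_def)
    then show ?thesis
      by (simp add: bounded_clinear_def linear_conv_bounded_linear scaleC_complex_def scaleC_scaleC)
  qed
  ultimately show ?thesis
    by (simp add: is_L_system_def interpolation_system_def bounded_clinear_matrix_vector_mult
        cadjoint_matrix_vector_mult cadjoint_scaleC_vector)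
qed

lemma minus_i_in_resolvent_set:
  fixes z :: "'n::{finite,linorder} \<Rightarrow> complex"
  assumes "\<And>k. Im (z k) > 0"
  shows "- \<i> \<in> resolvent_set (state_operator (interpolation_system z))"
proof -
  define A where "A = interpolation_matrix z - (\<chi> i j. if i = j then - \<i> else 0)"
  have A_apply: "(A *v x) $ j = (interpolation_matrix z *v x) $ j + \<i> * x $ j" for x j
  proof -
    have "(\<Sum>k\<in>UNIV. (if j = k then - \<i> else 0) * x $ k) = - \<i> * x $ j"
      by (simp add: if_distrib[of "\<lambda>a. a * _"] cong: if_cong)
    then show ?thesis
      by (simp add: A_def matrix_vector_mult_def left_diff_distrib sum_subtractf)
  qed
  have A: "state_operator (interpolation_system z) x - (- \<i>) *\<^sub>C x = A *v x" for x
    by (simp add: vec_eq_iff A_apply interpolation_system_def scaleC_vec_def scaleC_complex_def)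
  have ker_A: "x = 0" if "A *v x = 0" for x
  proof (rule ccontr)
    assume "x \<noteq> 0"
    then have "{k. x $ k \<noteq> 0} \<noteq> {}"
      by (auto simp: vec_eq_iff)
    define j where "j = Max {k. x $ k \<noteq> 0}"
    have j: "x $ j \<noteq> 0"
      using Max_in[OF _ \<open>{k. x $ k \<noteq> 0} \<noteq> {}\<close>] by (simp add: j_def)
    have above: "x $ k = 0" if "j < k" for k
      using Max_ge[of "{k. x $ k \<noteq> 0}" k] that leD by (fastforce simp: j_def)
    have "(interpolation_matrix z *v x) $ j = (\<Sum>k\<in>UNIV. if k = j then z j * x $ j else 0)"
      unfolding matrix_vector_mult_def vec_lambda_beta
      by (intro sum.cong) (auto simp: interpolation_matrix_def above)
    then have "(A *v x) $ j = (z j + \<i>) * x $ j"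
      by (simp add: A_apply algebra_simps)
    with that j have "z j + \<i> = 0"
      by simp
    then have "Im (z j) + 1 = 0"
      by (metis imaginary_unit.sel(2) plus_complex.sel(2) zero_complex.sel(2))
    with assms[of j] show False
      by simp
  qed
  obtain B where "B ** A = mat 1"
    using matrix_left_invertible_ker[of A] ker_A by blast
  then have BA: "B ** A = mat 1" and AB: "A ** B = mat 1"
    by (simp_all add: matrix_left_right_inverse)
  have "bij (\<lambda>x. A *v x)"
    by (rule o_bij[of "\<lambda>x. B *v x"])
      (simp_all add: fun_eq_iff matrix_vector_mul_assoc BA AB)
  moreover have "inv (\<lambda>x. A *v x) = (\<lambda>x. B *v x)"
    by (rule inv_equality) (simp_all add: matrix_vector_mul_assoc BA AB)
  ultimately show ?thesis
    by (simp add: resolvent_set_def A bounded_clinear_matrix_vector_mult)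
qed

end

theory Submission
  imports Defs
begin

text \<open>
  The transfer function of the interpolation system is a product over the nodes because the
  linear system defining it is triangular. If \<open>x\<close> solves \<open>(T - w) x = g\<close>, then row \<open>j\<close> involves
  only \<open>x $ j\<close> and the partial sum of \<open>g $ k * x $ k\<close> over \<open>k > j\<close>; back substitution from the
  last row upwards multiplies the corresponding partial value of \<open>W\<close> by
  \<open>(cnj (z j) - w) / (z j - w)\<close> in each step (\<open>back_substitution_product\<close>).
  At \<open>w = - \<i>\<close> the squared modulus of such a factor is the reciprocal of the quotient in the
  claim, and \<open>x \<mapsto> - eln x\<close> turns products of nonnegative reals into sums
  (\<open>minus_eln_prod\<close>). A node at \<open>\<i>\<close> gives a zero factor, hence an infinite summand; no summand
  is \<open>- \<infinity>\<close>, as every factor has modulus at most \<open>1\<close>.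
\<close>

text \<open>
  Truncating the output sum to the last rows makes back substitution an induction on the
  index set: such a set grows by its new least element \<open>b\<close>, and then the previous set is exactly
  the set of columns to the right of the diagonal in row \<open>b\<close>.
\<close>

lemma back_substitution_product:
  fixes z :: "'n::{finite,linorder} \<Rightarrow> complex" and x :: "(complex, 'n) vec"
  assumes pos: "\<And>k. Im (z k) > 0"
    and w: "\<And>k. z k \<noteq> w"
    and x: "interpolation_matrix z *v x - w *\<^sub>C x = interpolation_vector z"
    and upper: "\<And>j k. j \<in> A \<Longrightarrow> j < k \<Longrightarrow> k \<in> A"
  shows "1 - 2 * \<i> * (\<Sum>k\<in>A. complex_of_real (sqrt (Im (z k))) * x $ k)
    = (\<Prod>k\<in>A. (cnj (z k) - w) / (z k - w))"
proof -
  define s where "s k = complex_of_real (sqrt (Im (z k)))" for k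
  have "finite A" by simp
  then have "(\<forall>j\<in>A. \<forall>k>j. k \<in> A) \<longrightarrow>
    1 - 2 * \<i> * (\<Sum>k\<in>A. s k * x $ k) = (\<Prod>k\<in>A. (cnj (z k) - w) / (z k - w))"
  proof (induction A rule: finite_linorder_min_induct)
    case empty
    show ?case by simp
  next
    case (insert b A)
    show ?case
    proof
      assume up: "\<forall>j\<in>insert b A. \<forall>k>j. k \<in> insert b A"
      then have A: "A = {b<..}"
        using insert.hyps by auto
      define R where "R = 1 - 2 * \<i> * (\<Sum>k\<in>A. s k * x $ k)"
      have R: "R = (\<Prod>k\<in>A. (cnj (z k) - w) / (z k - w))"
        using insert.IH up insert.hyps unfolding R_def by fastforce
      have "(interpolation_matrix z *v x) $ b
          = (\<Sum>k\<in>UNIV. (if k = b then z b * x $ b else 0)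
              + (if k \<in> A then 2 * \<i> * s b * (s k * x $ k) else 0))"
        unfolding matrix_vector_mult_def vec_lambda_beta
        by (intro sum.cong) (auto simp: interpolation_matrix_def A s_def real_sqrt_mult)
      also have "\<dots> = z b * x $ b + 2 * \<i> * s b * (\<Sum>k\<in>A. s k * x $ k)"
        by (simp add: sum.distrib sum_distrib_left flip: sum.inter_restrict)
      finally have "z b * x $ b + 2 * \<i> * s b * (\<Sum>k\<in>A. s k * x $ k) - w * x $ b = s b"
        using arg_cong[OF x, of "\<lambda>v. v $ b"]
        by (simp add: scaleC_vec_def scaleC_complex_def interpolation_vector_def s_def)
      then have "(z b - w) * x $ b = s b * R"
        by (simp add: R_def algebra_simps)
      then have xb: "x $ b = s b * R / (z b - w)"
        using w[of b] by (simp add: field_simps)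
      have "s b * s b = complex_of_real (Im (z b))"
        using pos[of b] by (simp add: s_def flip: of_real_mult)
      moreover have "2 * \<i> * complex_of_real (Im (z b)) = z b - cnj (z b)"
        by (simp add: complex_diff_cnj)
      ultimately have ss: "2 * \<i> * (s b * s b) = z b - cnj (z b)"
        by simp
      have "b \<notin> A"
        using A by simp
      then have "1 - 2 * \<i> * (\<Sum>k\<in>insert b A. s k * x $ k) = R - 2 * \<i> * (s b * x $ b)"
        by (simp add: R_def algebra_simps)
      also have "\<dots> = R - 2 * \<i> * (s b * s b) * R / (z b - w)"
        by (simp add: xb)
      also have "\<dots> = (cnj (z b) - w) / (z b - w) * R"
        using w[of b] unfolding ss by (simp add: field_simps)
      also have "\<dots> = (\<Prod>k\<in>insert b A. (cnj (z k) - w) / (z k - w))"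
        using \<open>b \<notin> A\<close> by (simp add: R)
      finally show "1 - 2 * \<i> * (\<Sum>k\<in>insert b A. s k * x $ k)
        = (\<Prod>k\<in>insert b A. (cnj (z k) - w) / (z k - w))" .
    qed
  qed
  with upper show ?thesis
    by (auto simp: s_def)
qed

lemma transfer_function_interpolation_system:
  fixes z :: "'n::{finite,linorder} \<Rightarrow> complex"
  assumes pos: "\<And>k. Im (z k) > 0"
    and w: "\<And>k. z k \<noteq> w"
    and res: "w \<in> resolvent_set (state_operator (interpolation_system z))"
  shows "transfer_function (interpolation_system z) w
    = (\<Prod>k\<in>UNIV. (cnj (z k) - w) / (z k - w))"
proof -
  let ?T = "\<lambda>x. interpolation_matrix z *v x - w *\<^sub>C x"
  define x where "x = inv ?T (interpolation_vector z)"
  have "bij ?T"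
    using res by (simp add: resolvent_set_def interpolation_system_def)
  then have x: "?T x = interpolation_vector z"
    unfolding x_def by (rule surj_f_inv_f[of ?T, OF bij_is_surj])
  have "1 *\<^sub>C interpolation_vector z = interpolation_vector z"
    by (simp add: vec_eq_iff scaleC_vec_def scaleC_complex_def)
  then have "transfer_function (interpolation_system z) w
      = 1 - 2 * \<i> * cinner x (interpolation_vector z)"
    by (simp add: transfer_function_def interpolation_system_def cadjoint_scaleC_vector x_def)
  also have "cinner x (interpolation_vector z)
      = (\<Sum>k\<in>UNIV. complex_of_real (sqrt (Im (z k))) * x $ k)"
    by (simp add: cinner_vec_def cinner_complex_def interpolation_vector_def mult.commute)
  also have "1 - 2 * \<i> * \<dots> = (\<Prod>k\<in>UNIV. (cnj (z k) - w) / (z k - w))"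
    using pos w x by (rule back_substitution_product) simp
  finally show ?thesis .
qed

lemma minus_eln_prod:
  assumes "finite A" and "\<And>k. k \<in> A \<Longrightarrow> f k \<ge> 0"
  shows "- eln (ereal (\<Prod>k\<in>A. f k)) = (\<Sum>k\<in>A. - eln (ereal (f k)))"
  using assms
proof (induction A rule: finite_induct)
  case empty
  show ?case by (simp add: eln_def)
next
  case (insert b A)
  have "- eln (ereal (a * c)) = - eln (ereal a) + - eln (ereal c)" if "a \<ge> 0" "c \<ge> 0" for a c
  proof (cases "a = 0 \<or> c = 0")
    case True
    with that show ?thesis by (auto simp: eln_def)
  next
    case False
    with that have "a > 0" "c > 0" by auto
    moreover from this have "a * c > 0" by simp
    ultimately show ?thesis by (simp add: eln_def ln_mult not_le flip: ereal_less_eq)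
  qed
  from this[of "f b" "prod f A"] insert show ?case
    by (simp add: prod_nonneg)
qed

text \<open>
  The case \<open>q = 0\<close> is a node at \<open>\<i>\<close>: both sides are then infinite, since \<open>p / 0 = \<infinity>\<close> for
  extended reals \<open>p > 0\<close>.
\<close>

lemma half_eln_quotient:
  assumes "p > 0" and "q \<ge> 0"
  shows "ereal (1 / 2) * eln (ereal p / ereal q) = - eln (ereal (sqrt (q / p)))"
proof (cases "q = 0")
  case True
  with assms show ?thesis by (simp add: eln_def divide_ereal_def)
next
  case False
  with assms have "q > 0" by simp
  with assms show ?thesis
    by (simp add: eln_def not_le ln_sqrt ln_div field_simps)
qed

lemma eln_quotient_nonneg:
  assumes "q \<ge> 0" and "q \<le> p" and "p > 0"
  shows "eln (ereal p / ereal q) \<ge> 0"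
  using assms by (cases "q = 0") (auto simp: eln_def divide_ereal_def field_simps)

theorem theorem5:
  fixes z :: "'n::{finite,linorder} \<Rightarrow> complex"
  assumes "\<And>k. Im (z k) > 0"
  shows "c_entropy (interpolation_system z) =
    ereal (1 / 2) * (\<Sum>k\<in>UNIV.
      eln (ereal ((Re (z k))\<^sup>2 + (1 + Im (z k))\<^sup>2) / ereal ((Re (z k))\<^sup>2 + (1 - Im (z k))\<^sup>2)))"
proof -
  define p where "p k = (Re (z k))\<^sup>2 + (1 + Im (z k))\<^sup>2" for k
  define q where "q k = (Re (z k))\<^sup>2 + (1 - Im (z k))\<^sup>2" for k
  have p: "p k > 0" for k
    using assms[of k] by (simp add: p_def add_nonneg_pos)
  have q: "q k \<ge> 0" for k
    by (simp add: q_def)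
  have qp: "q k \<le> p k" for k
    using assms[of k] by (simp add: p_def q_def power2_eq_square algebra_simps)
  have ne: "z k \<noteq> - \<i>" for k
    using assms[of k] by auto
  have factor: "cmod ((cnj (z k) - - \<i>) / (z k - - \<i>)) = sqrt (q k / p k)" for k
  proof -
    have "cmod (cnj (z k) - - \<i>) = sqrt (q k)" "cmod (z k - - \<i>) = sqrt (p k)"
      by (simp_all add: cmod_def p_def q_def add.commute)
    then show ?thesis
      by (simp add: norm_divide real_sqrt_divide)
  qed
  have "c_entropy (interpolation_system z) = - eln (ereal (\<Prod>k\<in>UNIV. sqrt (q k / p k)))"
    unfolding c_entropy_def
      transfer_function_interpolation_system[OF assms ne minus_i_in_resolvent_set[OF assms]]
    by (simp only: factor flip: prod_norm)
  also have "\<dots> = (\<Sum>k\<in>UNIV. - eln (ereal (sqrt (q k / p k))))"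
    by (rule minus_eln_prod) (simp_all add: p q less_imp_le)
  also have "\<dots> = (\<Sum>k\<in>UNIV. ereal (1 / 2) * eln (ereal (p k) / ereal (q k)))"
    by (simp only: half_eln_quotient[OF p q])
  also have "\<dots> = ereal (1 / 2) * (\<Sum>k\<in>UNIV. eln (ereal (p k) / ereal (q k)))"
    by (rule sum_ereal_right_distrib[symmetric]) (rule eln_quotient_nonneg[OF q qp p])
  finally show ?thesis
    by (simp add: p_def q_def)
qed

end
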